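(* Let $K$ be a field of characteristic $0$ and $m\ge1$. A formal Laurent series $\sum_{\mathbf n\in\mathbb{Z}^m}b_{\mathbf n}x_1^{n_1}\cdots x_m^{n_m}$ with $b_{\mathbf n}\in K$ belongs to the field of iterated Laurent series $K\langle\!\langle x_1,\dots,x_m\rangle\!\rangle$ if and only if its support $\{\mathbf n\in\mathbb{Z}^m: b_{\mathbf n}\neq0\}$ is well-ordered with respect to the reverse lexicographic ordering on $\mathbb{Z}^m$.
   Context: $K\langle\!\langle x_1,\dots,x_m\rangle\!\rangle$ is defined inductively as $K\langle\!\langle x_1,\dots,x_{m-1}\rangle\!\rangle((x_m))$, the field of Laurent series in $x_m$ with coefficients in $K\langle\!\langle x_1,\dots,x_{m-1}\rangle\!\rangle$, starting from $K$ for $m=0$. An element of it is identified with the formal series in monomials $x_1^{n_1}\cdots x_m^{n_m}$, $\mathbf n\in\mathbb{Z}^m$, obtained by fully expanding. The reverse lexicographic ordering on $\mathbb{Z}^m$: $(n_1,\dots,n_m)<(k_1,\dots,k_m)$ iff there is an $i$ with $n_i<k_i$ and $n_j=k_j$ for all $j>i$. A totally ordered set is well-ordered if each nonempty subset has a least element. *)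

theory Defs
  imports "HOL-Algebra.Weak_Morphisms" "HOL-Library.FuncSet"
begin

definition char_zero :: "('a, 'b) ring_scheme \<Rightarrow> bool"
  where "char_zero K \<longleftrightarrow> (\<forall>n::nat. n > 0 \<longrightarrow> add_pow K n \<one>\<^bsub>K\<^esub> \<noteq> \<zero>\<^bsub>K\<^esub>)"

text \<open>
  The ring \<open>R((x))\<close> of Laurent series in one variable; a series is its coefficient function,
  which vanishes below some exponent. The index set of the convolution sum is finite for
  series in the carrier.
\<close>

definition laurent_ring :: "('a, 'b) ring_scheme \<Rightarrow> (int \<Rightarrow> 'a) ring"
  where "laurent_ring R =
    \<lparr> carrier = {f. (\<forall>n. f n \<in> carrier R) \<and> (\<exists>N. \<forall>n<N. f n = \<zero>\<^bsub>R\<^esub>)},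
      mult = (\<lambda>f g n. finsum R (\<lambda>i. f i \<otimes>\<^bsub>R\<^esub> g (n - i))
                 {i. f i \<noteq> \<zero>\<^bsub>R\<^esub> \<and> g (n - i) \<noteq> \<zero>\<^bsub>R\<^esub>}),
      one = (\<lambda>n. if n = 0 then \<one>\<^bsub>R\<^esub> else \<zero>\<^bsub>R\<^esub>),
      zero = (\<lambda>n. \<zero>\<^bsub>R\<^esub>),
      add = (\<lambda>f g n. f n \<oplus>\<^bsub>R\<^esub> g n) \<rparr>"

text \<open>
  Iterating \<open>laurent_ring\<close> changes the element type at every step. To let the number of
  variables be an ordinary natural number, each stage is transported along an injective
  constructor into the following type.
\<close>

datatype 'a iter_series = Const 'a | Series "int \<Rightarrow> 'a iter_series"

primrec iterated_laurent :: "('a, 'b) ring_scheme \<Rightarrow> nat \<Rightarrow> 'a iter_series ring"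
  where
    "iterated_laurent K 0 = image_ring Const K"
  | "iterated_laurent K (Suc m) = image_ring Series (laurent_ring (iterated_laurent K m))"

definition exponents :: "nat \<Rightarrow> int list set"
  where "exponents m = {ns. length ns = m}"

text \<open>
  The outermost variable is the last one, so its exponent is the last entry of the list.
\<close>

primrec full_coeff :: "'a iter_series \<Rightarrow> int list \<Rightarrow> 'a"
  where
    "full_coeff (Const c) ns = c"
  | "full_coeff (Series f) ns = full_coeff (f (last ns)) (butlast ns)"

definition expansion :: "nat \<Rightarrow> 'a iter_series \<Rightarrow> int list \<Rightarrow> 'a"
  where "expansion m F = restrict (full_coeff F) (exponents m)"

definition formal_series :: "('a, 'b) ring_scheme \<Rightarrow> nat \<Rightarrow> (int list \<Rightarrow> 'a) set"
  where "formal_series K m = (exponents m \<rightarrow>\<^sub>E carrier K)"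

definition series_support :: "('a, 'b) ring_scheme \<Rightarrow> nat \<Rightarrow> (int list \<Rightarrow> 'a) \<Rightarrow> int list set"
  where "series_support K m b = {ns \<in> exponents m. b ns \<noteq> \<zero>\<^bsub>K\<^esub>}"

definition revlex_less :: "nat \<Rightarrow> int list \<Rightarrow> int list \<Rightarrow> bool"
  where "revlex_less m ns ks \<longleftrightarrow>
    (\<exists>i<m. ns ! i < ks ! i \<and> (\<forall>j. i < j \<and> j < m \<longrightarrow> ns ! j = ks ! j))"

definition revlex :: "nat \<Rightarrow> int list rel"
  where "revlex m = {(ns, ks). ns \<in> exponents m \<and> ks \<in> exponents m \<and>
                               (ns = ks \<or> revlex_less m ns ks)}"

definition revlex_well_ordered :: "nat \<Rightarrow> int list set \<Rightarrow> bool"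
  where "revlex_well_ordered m A \<longleftrightarrow> well_order_on A (Restr (revlex m) A)"


text \<open>An iterated series may be identified with its full expansion.\<close>

lemma carrier_iterated_laurent_Suc:
  "carrier (iterated_laurent K (Suc m)) =
     Series ` {f. (\<forall>n. f n \<in> carrier (iterated_laurent K m)) \<and>
                  (\<exists>N. \<forall>n<N. f n = \<zero>\<^bsub>iterated_laurent K m\<^esub>)}"
  by (simp add: image_ring_carrier laurent_ring_def)

lemma inj_on_expansion: "inj_on (expansion m) (carrier (iterated_laurent K m))"
proof (induction m)
  case 0
  show ?case
    by (auto simp: inj_on_def image_ring_carrier expansion_def exponents_def fun_eq_iff
        dest: spec[of _ "[]"])
next
  case (Suc m)
  show ?case
  proof (rule inj_onI)
    fix F G
    assume "F \<in> carrier (iterated_laurent K (Suc m))" "G \<in> carrier (iterated_laurent K (Suc m))"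
      and eq: "expansion (Suc m) F = expansion (Suc m) G"
    then obtain f g where fg: "F = Series f" "G = Series g"
      "\<And>n. f n \<in> carrier (iterated_laurent K m)" "\<And>n. g n \<in> carrier (iterated_laurent K m)"
      unfolding carrier_iterated_laurent_Suc by auto
    have "expansion m (f n) = expansion m (g n)" for n
    proof
      fix ns
      show "expansion m (f n) ns = expansion m (g n) ns"
        using fun_cong[OF eq, of "ns @ [n]"] fg(1,2)
        by (auto simp: expansion_def exponents_def)
    qed
    then show "F = G"
      using Suc.IH fg by (auto simp: inj_on_def)
  qed
qed

lemma revlex_less_linear:
  assumes "ns \<in> exponents m" "ks \<in> exponents m" "ns \<noteq> ks"
  shows "revlex_less m ns ks \<or> revlex_less m ks ns"
proof -
  define D where "D = {i. i < m \<and> ns ! i \<noteq> ks ! i}"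
  have "D \<noteq> {}" "finite D"
    using assms by (auto simp: D_def exponents_def list_eq_iff_nth_eq)
  then have "Max D \<in> D" and "\<And>j. j \<in> D \<Longrightarrow> j \<le> Max D"
    using Max_in Max_ge by blast+
  then obtain d where d: "d \<in> D" "\<And>j. j \<in> D \<Longrightarrow> j \<le> d"
    by blast
  have above: "ns ! j = ks ! j" if "d < j" "j < m" for j
    using d(2)[of j] that by (force simp: D_def)
  have "d < m" "ns ! d < ks ! d \<or> ks ! d < ns ! d"
    using d(1) by (auto simp: D_def)
  then show ?thesis
    unfolding revlex_less_def by (metis above)
qed

lemma revlex_less_trans:
  assumes "revlex_less m ns ks" "revlex_less m ks ls"
  shows "revlex_less m ns ls"
proof -
  obtain i j where
    i: "i < m" "ns ! i < ks ! i" "\<forall>l. i < l \<and> l < m \<longrightarrow> ns ! l = ks ! l" and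
    j: "j < m" "ks ! j < ls ! j" "\<forall>l. j < l \<and> l < m \<longrightarrow> ks ! l = ls ! l"
    using assms unfolding revlex_less_def by blast
  have "ns ! max i j < ls ! max i j"
    using i j by (cases i j rule: linorder_cases) (auto simp: max_def)
  then show ?thesis
    unfolding revlex_less_def using i j by (intro exI[of _ "max i j"]) auto
qed

lemma revlex_less_irrefl: "\<not> revlex_less m ns ns"
  by (auto simp: revlex_less_def)

text \<open>Well-orderedness in terms of least elements.\<close>

lemma revlex_well_ordered_iff:
  assumes "A \<subseteq> exponents m"
  shows "revlex_well_ordered m A \<longleftrightarrow>
    (\<forall>B\<subseteq>A. B \<noteq> {} \<longrightarrow> (\<exists>l\<in>B. \<forall>x\<in>B. (l, x) \<in> revlex m))"
proof -
  have "trans (revlex m)"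
    by (rule transI) (auto simp: revlex_def intro: revlex_less_trans)
  moreover have as: "antisym (revlex m)"
    using revlex_less_trans revlex_less_irrefl by (intro antisymI) (auto simp: revlex_def, blast+)
  moreover have rf: "refl_on A (Restr (revlex m) A)"
    using assms by (auto simp: refl_on_def revlex_def)
  moreover have tot: "total_on A (Restr (revlex m) A)"
    using assms revlex_less_linear by (fastforce simp: total_on_def revlex_def)
  ultimately have lin: "linear_order_on A (Restr (revlex m) A)"
    unfolding order_on_defs by (simp add: trans_Restr antisym_Restr)
  have "wf (Restr (revlex m) A - Id) \<longleftrightarrow>
    (\<forall>B\<subseteq>A. B \<noteq> {} \<longrightarrow> (\<exists>l\<in>B. \<forall>x\<in>B. (l, x) \<in> revlex m))" (is "?L \<longleftrightarrow> ?R")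
  proof
    assume ?L
    show ?R
    proof (intro allI impI)
      fix B assume B: "B \<subseteq> A" "B \<noteq> {}"
      then obtain x0 where "x0 \<in> B" by blast
      then obtain l where l: "l \<in> B" "\<And>y. (y, l) \<in> Restr (revlex m) A - Id \<Longrightarrow> y \<notin> B"
        by (rule wfE_min[OF \<open>?L\<close>]) blast
      have "(l, x) \<in> revlex m" if "x \<in> B" for x
      proof (cases "x = l")
        case True
        then show ?thesis
          using rf l(1) B(1) by (auto simp: refl_on_def)
      next
        case False
        then show ?thesis
          using tot l that B(1) unfolding total_on_def by blast
      qed
      then show "\<exists>l\<in>B. \<forall>x\<in>B. (l, x) \<in> revlex m"
        using l(1) by blast
    qed
  next
    assume R: ?R
    show ?L
    proof (rule wfI_min)
      fix x Q assume x: "x \<in> (Q :: int list set)"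
      show "\<exists>z\<in>Q. \<forall>y. (y, z) \<in> Restr (revlex m) A - Id \<longrightarrow> y \<notin> Q"
      proof (cases "Q \<inter> A = {}")
        case True
        then show ?thesis using x by blast
      next
        case False
        then obtain l where l: "l \<in> Q \<inter> A" "\<And>y. y \<in> Q \<inter> A \<Longrightarrow> (l, y) \<in> revlex m"
          using R[rule_format, of "Q \<inter> A"] by blast
        have "y \<notin> Q" if "(y, l) \<in> Restr (revlex m) A - Id" for y
          using as l(2)[of y] that unfolding antisym_def by blast
        then show ?thesis using l(1) by blast
      qed
    qed
  qed
  then show ?thesis
    unfolding revlex_well_ordered_def well_order_on_def using lin by blast
qed

end

theory Submission
  imports Defs
begin

text \<open>
  Fixing the last exponent slices a series in \<open>m + 1\<close> variables into series in \<open>m\<close> variables.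
  Both sides of the equivalence hold for a series if and only if they hold for all of its slices and
  the slices vanish for all sufficiently negative last exponents. The theorem follows by induction
  on \<open>m\<close>.
\<close>

text \<open>The \<open>restrict\<close> keeps slices extensional, so that they lie in
  \<open>formal_series K m\<close> and can equal values of \<open>expansion m\<close> as
  functions.\<close>

definition slice :: "nat \<Rightarrow> (int list \<Rightarrow> 'a) \<Rightarrow> int \<Rightarrow> int list \<Rightarrow> 'a"
  where "slice m b n = restrict (\<lambda>ns. b (ns @ [n])) (exponents m)"

definition support_slice :: "nat \<Rightarrow> int list set \<Rightarrow> int \<Rightarrow> int list set"
  where "support_slice m A n = {ns \<in> exponents m. ns @ [n] \<in> A}"

section \<open>Well-ordered sets of exponents and their slices\<close>

lemma append_in_exponents_Suc [simp]: "ns @ [n] \<in> exponents (Suc m) \<longleftrightarrow> ns \<in> exponents m"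
  by (simp add: exponents_def)

lemma exponents_SucE:
  assumes "ns \<in> exponents (Suc m)"
  obtains ns' n where "ns = ns' @ [n]" "ns' \<in> exponents m"
  using assms by (cases ns rule: rev_cases) (auto simp: exponents_def)

text \<open>The last entry is the most significant one. A deciding position \<open>m\<close> gives
  \<open>a < c\<close>; any earlier deciding position forces agreement at \<open>m\<close>, hence
  \<open>a = c\<close>, and decides the order of the prefixes.\<close>

lemma revlex_append_iff:
  assumes "ns \<in> exponents m" "ks \<in> exponents m"
  shows "(ns @ [a], ks @ [c]) \<in> revlex (Suc m) \<longleftrightarrow> a < c \<or> a = c \<and> (ns, ks) \<in> revlex m"
proof -
  have len: "length ns = m" "length ks = m"
    using assms by (auto simp: exponents_def)
  have "revlex_less (Suc m) (ns @ [a]) (ks @ [c]) \<longleftrightarrow> a < c \<or> a = c \<and> revlex_less m ns ks"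
    (is "?L \<longleftrightarrow> ?R")
  proof
    assume ?L
    then obtain i where i: "i < Suc m" "(ns @ [a]) ! i < (ks @ [c]) ! i"
      "\<And>j. i < j \<Longrightarrow> j < Suc m \<Longrightarrow> (ns @ [a]) ! j = (ks @ [c]) ! j"
      unfolding revlex_less_def by blast
    show ?R
    proof (cases "i = m")
      case True
      then show ?thesis using i(2) len by (simp add: nth_append)
    next
      case False
      then have "i < m" using i(1) by simp
      moreover have "ns ! j = ks ! j" if "i < j" "j < m" for j
        using i(3)[of j] that len by (simp add: nth_append)
      ultimately have "revlex_less m ns ks"
        unfolding revlex_less_def using i(2) len by (auto simp: nth_append)
      moreover have "a = c"
        using i(3)[of m] \<open>i < m\<close> len by (simp add: nth_append)
      ultimately show ?thesis by simp
    qed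
  next
    assume ?R
    then show ?L
    proof (elim disjE conjE)
      assume "a < c"
      then show ?L
        unfolding revlex_less_def using len by (intro exI[of _ m]) (auto simp: nth_append)
    next
      assume "a = c" "revlex_less m ns ks"
      then show ?L
        unfolding revlex_less_def using len by (auto simp: nth_append less_Suc_eq)
    qed
  qed
  then show ?thesis
    using assms by (auto simp: revlex_def)
qed

text \<open>Since the last entry dominates, each slice embeds into \<open>A\<close> with its order,
  and the least element of \<open>A\<close> bounds the last entries from below. Conversely, a least
  element of a nonempty subset is found by first minimising the last entry and then minimising
  within that slice.\<close>

lemma revlex_well_ordered_Suc_iff:
  assumes A: "A \<subseteq> exponents (Suc m)"
  shows "revlex_well_ordered (Suc m) A \<longleftrightarrow>
    (\<forall>n. revlex_well_ordered m (support_slice m A n)) \<and>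
    (\<exists>N. \<forall>n<N. support_slice m A n = {})"
proof -
  have sub: "support_slice m A n \<subseteq> exponents m" for n
    by (auto simp: support_slice_def)
  note iff = revlex_well_ordered_iff[OF A] revlex_well_ordered_iff[OF sub]
  show ?thesis
  proof (intro iffI conjI allI)
    fix n
    assume wo: "revlex_well_ordered (Suc m) A"
    show "revlex_well_ordered m (support_slice m A n)"
      unfolding iff
    proof (intro allI impI)
      fix B assume B: "B \<subseteq> support_slice m A n" "B \<noteq> {}"
      \<comment> \<open>Appending \<open>n\<close> moves \<open>B\<close> into \<open>A\<close>,
        where a least element exists. All last entries equal \<open>n\<close>, so the order there is
        that of the prefixes.\<close>
      have "(\<lambda>ns. ns @ [n]) ` B \<subseteq> A" "(\<lambda>ns. ns @ [n]) ` B \<noteq> {}"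
        using B by (auto simp: support_slice_def)
      then obtain l where l: "l \<in> B" "\<forall>x\<in>B. (l @ [n], x @ [n]) \<in> revlex (Suc m)"
        using wo[unfolded iff, rule_format, of "(\<lambda>ns. ns @ [n]) ` B"] by auto
      moreover have "B \<subseteq> exponents m"
        using B(1) sub by blast
      ultimately show "\<exists>l\<in>B. \<forall>x\<in>B. (l, x) \<in> revlex m"
        by (metis less_irrefl revlex_append_iff subsetD)
    qed
  next
    assume wo: "revlex_well_ordered (Suc m) A"
    show "\<exists>N. \<forall>n<N. support_slice m A n = {}"
    proof (cases "A = {}")
      case True
      then show ?thesis by (simp add: support_slice_def)
    next
      case False
      then obtain l where l: "l \<in> A" "\<And>x. x \<in> A \<Longrightarrow> (l, x) \<in> revlex (Suc m)"
        using wo[unfolded iff, rule_format, of A] by blast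
      \<comment> \<open>The bound \<open>N\<close> is the last entry of the least element: anything
        in \<open>A\<close> with a smaller last entry would lie below \<open>l\<close>.\<close>
      then obtain l' N where l': "l = l' @ [N]" "l' \<in> exponents m"
        using A exponents_SucE by (metis subsetD)
      have "support_slice m A n = {}" if "n < N" for n
        using l(2) that l' by (force simp: support_slice_def revlex_append_iff)
      then show ?thesis by blast
    qed
  next
    assume "(\<forall>n. revlex_well_ordered m (support_slice m A n)) \<and>
      (\<exists>N. \<forall>n<N. support_slice m A n = {})"
    then obtain N where wo: "\<And>n. revlex_well_ordered m (support_slice m A n)"
      and N: "\<And>n. n < N \<Longrightarrow> support_slice m A n = {}"
      by blast
    show "revlex_well_ordered (Suc m) A"
      unfolding iff
    proof (intro allI impI)
      fix B assume B: "B \<subseteq> A" "B \<noteq> {}"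
      \<comment> \<open>Last entries of elements of \<open>B\<close> are at least \<open>N\<close>;
        measuring them from \<open>N\<close> makes them natural numbers, so that a least one
        exists.\<close>
      define P where "P k \<longleftrightarrow> support_slice m B (N + int k) \<noteq> {}" for k
      have lower: "N \<le> n" if "ns @ [n] \<in> B" "ns \<in> exponents m" for ns n
        using N[of n] that B(1) by (force simp: support_slice_def)
      obtain ns n where "ns @ [n] \<in> B" "ns \<in> exponents m"
        using B A exponents_SucE by (metis ex_in_conv subsetD)
      with lower have "P (nat (n - N))"
        by (auto simp: P_def support_slice_def)
      then have P: "P (Least P)"
        by (rule LeastI)
      have least: "Least P \<le> k" if "P k" for k
        using that by (rule Least_le)
      \<comment> \<open>\<open>d\<close> is the smallest last entry occurring in \<open>B\<close>;
        the least element of the slice at \<open>d\<close>, extended by \<open>d\<close>, will be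
        least in \<open>B\<close>.\<close>
      define d where "d = N + int (Least P)"
      have "support_slice m B d \<subseteq> support_slice m A d" "support_slice m B d \<noteq> {}"
        using B(1) P by (auto simp: P_def d_def support_slice_def)
      then obtain l where l: "l \<in> support_slice m B d"
        "\<And>x. x \<in> support_slice m B d \<Longrightarrow> (l, x) \<in> revlex m"
        using wo[of d, unfolded iff, rule_format, of "support_slice m B d"] by blast
      have "(l @ [d], x) \<in> revlex (Suc m)" if x: "x \<in> B" for x
      proof -
        obtain y c where y: "x = y @ [c]" "y \<in> exponents m"
          using x B(1) A exponents_SucE by (metis subsetD)
        then have "P (nat (c - N))" "N \<le> c"
          using lower[of y c] x by (auto simp: P_def support_slice_def)
        then have "d \<le> c"
          using least[of "nat (c - N)"] by (simp add: d_def)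
        then show ?thesis
          using l x y by (auto simp: revlex_append_iff support_slice_def)
      qed
      then show "\<exists>l\<in>B. \<forall>x\<in>B. (l, x) \<in> revlex (Suc m)"
        using l(1) by (auto simp: support_slice_def)
    qed
  qed
qed

section \<open>Coefficients and slices of iterated Laurent series\<close>

lemma zero_iterated_laurent_Suc:
  "\<zero>\<^bsub>iterated_laurent K (Suc m)\<^esub> = Series (\<lambda>n. \<zero>\<^bsub>iterated_laurent K m\<^esub>)"
  by (simp add: image_ring_zero laurent_ring_def)

lemma zero_in_carrier_iterated_laurent:
  assumes "\<zero>\<^bsub>K\<^esub> \<in> carrier K"
  shows "\<zero>\<^bsub>iterated_laurent K m\<^esub> \<in> carrier (iterated_laurent K m)"
proof (induction m)
  case 0
  then show ?case using assms by (simp add: image_ring_zero image_ring_carrier)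
next
  case (Suc m)
  then show ?case
    unfolding carrier_iterated_laurent_Suc zero_iterated_laurent_Suc by blast
qed

text \<open>The zero is a constant function at every stage, so the length of \<open>ns\<close> and
  the unspecified value of \<open>last []\<close> do not matter.\<close>

lemma full_coeff_zero: "full_coeff \<zero>\<^bsub>iterated_laurent K m\<^esub> ns = \<zero>\<^bsub>K\<^esub>"
proof (induction m arbitrary: ns)
  case 0
  then show ?case by (simp add: image_ring_zero)
next
  case (Suc m)
  then show ?case by (simp only: zero_iterated_laurent_Suc full_coeff.simps)
qed

lemma full_coeff_in_carrier:
  "F \<in> carrier (iterated_laurent K m) \<Longrightarrow> full_coeff F ns \<in> carrier K"
proof (induction m arbitrary: F ns)
  case 0
  then show ?case by (auto simp: image_ring_carrier)
next
  case (Suc m)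
  then show ?case
    unfolding carrier_iterated_laurent_Suc by auto
qed

lemma slice_in_formal_series:
  "b \<in> formal_series K (Suc m) \<Longrightarrow> slice m b n \<in> formal_series K m"
  by (auto simp: slice_def formal_series_def)

text \<open>Expansion reads the exponent of the outermost variable off the end of the list, exactly
  where slicing puts it.\<close>

lemma slice_expansion: "slice m (expansion (Suc m) (Series f)) n = expansion m (f n)"
  by (auto simp: slice_def expansion_def restrict_def)

lemma formal_series_eqI:
  assumes "b \<in> formal_series K (Suc m)" "c \<in> formal_series K (Suc m)"
    and "\<And>n. slice m b n = slice m c n"
  shows "b = c"
proof (rule PiE_ext)
  show "b \<in> exponents (Suc m) \<rightarrow>\<^sub>E carrier K" "c \<in> exponents (Suc m) \<rightarrow>\<^sub>E carrier K"
    using assms by (simp_all add: formal_series_def)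
  fix ns assume "ns \<in> exponents (Suc m)"
  then obtain ks n where "ns = ks @ [n]" "ks \<in> exponents m"
    by (rule exponents_SucE)
  then show "b ns = c ns"
    using fun_cong[OF assms(3)[of n], of ks] by (simp add: slice_def)
qed

lemma expansion_in_formal_series:
  "F \<in> carrier (iterated_laurent K m) \<Longrightarrow> expansion m F \<in> formal_series K m"
  by (auto simp: expansion_def formal_series_def full_coeff_in_carrier)

text \<open>An empty support means having the same expansion as zero, and expansion is injective on
  the carrier. This turns vanishing of Laurent coefficients into a condition on supports.\<close>

lemma expansion_eq_zero_iff:
  assumes "\<zero>\<^bsub>K\<^esub> \<in> carrier K" "F \<in> carrier (iterated_laurent K m)"
  shows "series_support K m (expansion m F) = {} \<longleftrightarrow> F = \<zero>\<^bsub>iterated_laurent K m\<^esub>"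
proof -
  have "series_support K m (expansion m F) = {} \<longleftrightarrow>
    expansion m F = expansion m \<zero>\<^bsub>iterated_laurent K m\<^esub>"
    by (auto simp: series_support_def expansion_def restrict_def fun_eq_iff full_coeff_zero)
  then show ?thesis
    using inj_on_expansion zero_in_carrier_iterated_laurent[OF assms(1)] assms(2)
    by (metis inj_on_def)
qed

lemma series_support_slice:
  "series_support K m (slice m b n) = support_slice m (series_support K (Suc m) b) n"
  by (auto simp: series_support_def support_slice_def slice_def)

text \<open>The slices of the expansion of \<open>Series f\<close> are the expansions of the
  coefficients \<open>f n\<close>. So membership splits into membership of every slice and the lower
  bound in the definition of Laurent series.\<close>

lemma expansion_image_Suc_iff:
  assumes zero: "\<zero>\<^bsub>K\<^esub> \<in> carrier K" and b: "b \<in> formal_series K (Suc m)"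
  shows "b \<in> expansion (Suc m) ` carrier (iterated_laurent K (Suc m)) \<longleftrightarrow>
    (\<forall>n. slice m b n \<in> expansion m ` carrier (iterated_laurent K m)) \<and>
    (\<exists>N. \<forall>n<N. series_support K m (slice m b n) = {})"
proof
  assume "b \<in> expansion (Suc m) ` carrier (iterated_laurent K (Suc m))"
  then obtain f N where f: "b = expansion (Suc m) (Series f)"
    "\<And>n. f n \<in> carrier (iterated_laurent K m)"
    "\<And>n. n < N \<Longrightarrow> f n = \<zero>\<^bsub>iterated_laurent K m\<^esub>"
    unfolding carrier_iterated_laurent_Suc by auto
  have "series_support K m (slice m b n) = {}" if "n < N" for n
    unfolding f(1) slice_expansion expansion_eq_zero_iff[OF zero f(2)] using that by (rule f(3))
  then show "(\<forall>n. slice m b n \<in> expansion m ` carrier (iterated_laurent K m)) \<and>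
    (\<exists>N. \<forall>n<N. series_support K m (slice m b n) = {})"
    using f(1,2) by (auto simp: slice_expansion)
next
  assume "(\<forall>n. slice m b n \<in> expansion m ` carrier (iterated_laurent K m)) \<and>
    (\<exists>N. \<forall>n<N. series_support K m (slice m b n) = {})"
  then obtain N where im: "\<forall>n. \<exists>F. F \<in> carrier (iterated_laurent K m) \<and> slice m b n = expansion m F"
    and N: "\<And>n. n < N \<Longrightarrow> series_support K m (slice m b n) = {}"
    by blast
  \<comment> \<open>Preimages of the slices are chosen to serve as the Laurent coefficients of the
    series to be built.\<close>
  obtain f where f: "\<And>n. f n \<in> carrier (iterated_laurent K m)"
    "\<And>n. slice m b n = expansion m (f n)"
    using choice[OF im] by blast
  \<comment> \<open>The carrier asks for the zero of the coefficient ring itself; injectivity of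
    expansion yields it from the empty support.\<close>
  have "f n = \<zero>\<^bsub>iterated_laurent K m\<^esub>" if "n < N" for n
    using N[OF that] expansion_eq_zero_iff[OF zero f(1)] f(2) by simp
  then have F: "Series f \<in> carrier (iterated_laurent K (Suc m))"
    unfolding carrier_iterated_laurent_Suc using f(1) by blast
  have "b = expansion (Suc m) (Series f)"
    using b expansion_in_formal_series[OF F]
    by (rule formal_series_eqI) (simp add: slice_expansion f(2))
  then show "b \<in> expansion (Suc m) ` carrier (iterated_laurent K (Suc m))"
    using F by blast
qed

text \<open>Both sides satisfy the same recursion in \<open>m\<close>, and the induction starts
  without variables, where both are always true.\<close>

lemma expansion_image_iff_revlex_well_ordered:
  assumes zero: "\<zero>\<^bsub>K\<^esub> \<in> carrier K" and "b \<in> formal_series K m"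
  shows "b \<in> expansion m ` carrier (iterated_laurent K m) \<longleftrightarrow>
    revlex_well_ordered m (series_support K m b)"
  using assms(2)
proof (induction m arbitrary: b)
  case 0
  \<comment> \<open>The empty list is the only exponent, so \<open>b\<close> amounts to the constant
    \<open>b []\<close> and its support has at most one element.\<close>
  have "exponents 0 = {[]}"
    by (auto simp: exponents_def)
  then have "b = expansion 0 (Const (b []))" "b [] \<in> carrier K"
    using 0 by (auto simp: formal_series_def expansion_def fun_eq_iff restrict_def PiE_def
        extensional_def)
  then have "b \<in> expansion 0 ` carrier (iterated_laurent K 0)"
    by (auto simp: image_ring_carrier)
  moreover have "revlex_well_ordered 0 (series_support K 0 b)"
  proof -
    have "series_support K 0 b \<subseteq> {[]}" "([], []) \<in> revlex 0"
      by (auto simp: series_support_def exponents_def revlex_def)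
    then show ?thesis
      by (subst revlex_well_ordered_iff) (auto simp: exponents_def, blast)
  qed
  ultimately show ?case by blast
next
  case (Suc m)
  have "series_support K (Suc m) b \<subseteq> exponents (Suc m)"
    by (auto simp: series_support_def)
  then show ?case
    \<comment> \<open>The induction hypothesis handles each slice; the two lower bounds agree
      because taking supports commutes with slicing.\<close>
    using Suc.IH[OF slice_in_formal_series[OF Suc.prems]]
    by (simp add: expansion_image_Suc_iff[OF zero Suc.prems] revlex_well_ordered_Suc_iff
        series_support_slice del: iterated_laurent.simps)
qed

theorem mainTheorem4:
  fixes K :: "('a, 'b) ring_scheme" and m :: nat and b :: "int list \<Rightarrow> 'a"
  assumes "field K" and "char_zero K" and "m \<ge> 1"
    and "b \<in> formal_series K m"
  shows "b \<in> expansion m ` carrier (iterated_laurent K m) \<longleftrightarrow>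
    revlex_well_ordered m (series_support K m b)"
proof -
  interpret field K by fact
  show ?thesis
    using zero_closed assms(4) by (rule expansion_image_iff_revlex_well_ordered)
qed

end
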